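(* Let $\mathcal H=(V,E)$ be an $r$-uniform hypergraph with $\chi(\mathcal H)=d+1$, where $d\ge 1$. Fix $m\in\mathbb N$ and let $\mathcal G\in\mathcal A(\mathcal H,m)$. Then for any coloring of the vertices of $\mathcal G$ into $d$ colors there exist pairwise disjoint vertex sets $W_1,\dots,W_r$ of $\mathcal G$, each of size $\lceil m/d\rceil$, such that every set $\{w_1,\dots,w_r\}$ with $w_j\in W_j$ is an edge of $\mathcal G$ (i.e. $\mathcal G$ contains a copy of $K^r[\lceil m/d\rceil]$), and all vertices of $W_1\cup\dots\cup W_r$ have the same color. Moreover, for any $0<p<1$, $$\Pr[\chi(\mathcal G(p))\le d]\le |E|\binom{m}{\lceil m/d\rceil}^r(1-p)^{\lceil m/d\rceil^r}.$$
   Context: For an $r$-uniform hypergraph $\mathcal H=(V,E)$ and $m\in\mathbb N$, the $m$-blow-up $\mathcal H[m]=(V',E')$ has $V'=V\times[m]$ and $E'=\{\{(v_1,i_1),\dots,(v_r,i_r)\}:\{v_1,\dots,v_r\}\in E,\ i_1,\dots,i_r\in[m]\}$. Let $\mathcal F$ be the class of functions $f:V'\to[N]$ (for some $N$) such that: (1) for every $v\in V$ and $i\ne j$, $f((v,i))\ne f((v,j))$; (2) for every $e\in E'$ and distinct $x,y\in e$, $f(x)\ne f(y)$; (3) $f$ is surjective. Then $\mathcal A(\mathcal H,m)$ is the class of hypergraphs $(f(V'),E_f)$ with $f\in\mathcal F$ and $E_f=\{\{f(x_1),\dots,f(x_r)\}:\{x_1,\dots,x_r\}\in E'\}$. $K^r[t]$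 denotes the complete $r$-partite $r$-uniform hypergraph with parts of size $t$. $\chi$ denotes the chromatic number (least number of colors in a vertex coloring with no monochromatic edge). For $p\in(0,1)$, $\mathcal G(p)$ is the random hypergraph on the vertex set of $\mathcal G$ containing each edge of $\mathcal G$ independently with probability $p$. *)

theory Defs
  imports "HOL-Probability.Product_PMF" "HOL-Library.Extended_Nat"
begin

datatype 'a hypergraph = Hypergraph (verts: "'a set") (edges: "'a set set")

definition uniform_hypergraph :: "nat \<Rightarrow> 'a hypergraph \<Rightarrow> bool" where
  "uniform_hypergraph r H \<longleftrightarrow>
     finite (verts H) \<and> (\<forall>e\<in>edges H. e \<subseteq> verts H \<and> card e = r)"

definition monochromatic :: "('a \<Rightarrow> nat) \<Rightarrow> 'a set \<Rightarrow> bool" where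
  "monochromatic c S \<longleftrightarrow> (\<exists>a. \<forall>x\<in>S. c x = a)"

definition proper_coloring :: "'a hypergraph \<Rightarrow> nat \<Rightarrow> ('a \<Rightarrow> nat) \<Rightarrow> bool" where
  "proper_coloring H k c \<longleftrightarrow>
     c \<in> verts H \<rightarrow> {1..k} \<and> (\<forall>e\<in>edges H. \<not> monochromatic c e)"

text \<open>The value is \<open>\<infinity>\<close> when there is no proper coloring at all, i.e. when some edge
  has at most one vertex.\<close>

definition chromatic_number :: "'a hypergraph \<Rightarrow> enat" where
  "chromatic_number H = Inf {enat k | k. \<exists>c. proper_coloring H k c}"

text \<open>An edge \<open>{(v\<^sub>1,i\<^sub>1),\<dots>,(v\<^sub>r,i\<^sub>r)}\<close> of the blow-up is the graph of an index function
  \<open>i\<close> on the edge \<open>e = {v\<^sub>1,\<dots>,v\<^sub>r}\<close>.\<close>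

definition blow_up :: "'a hypergraph \<Rightarrow> nat \<Rightarrow> ('a \<times> nat) hypergraph" where
  "blow_up H m = Hypergraph (verts H \<times> {1..m})
     {(\<lambda>v. (v, i v)) ` e | e i. e \<in> edges H \<and> i \<in> e \<rightarrow> {1..m}}"

definition admissible_map :: "'a hypergraph \<Rightarrow> nat \<Rightarrow> nat \<Rightarrow> ('a \<times> nat \<Rightarrow> nat) \<Rightarrow> bool" where
  "admissible_map H m N f \<longleftrightarrow>
     (\<forall>v\<in>verts H. \<forall>i\<in>{1..m}. \<forall>j\<in>{1..m}. i \<noteq> j \<longrightarrow> f (v, i) \<noteq> f (v, j)) \<and>
     (\<forall>e\<in>edges (blow_up H m). \<forall>x\<in>e. \<forall>y\<in>e. x \<noteq> y \<longrightarrow> f x \<noteq> f y) \<and>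
     f ` verts (blow_up H m) = {1..N}"

definition image_hypergraph :: "('a \<Rightarrow> 'b) \<Rightarrow> 'a hypergraph \<Rightarrow> 'b hypergraph" where
  "image_hypergraph f H = Hypergraph (f ` verts H) ((\<lambda>e. f ` e) ` edges H)"

text \<open>The class \<open>\<A>(H, m)\<close>.\<close>

definition blow_up_images :: "'a hypergraph \<Rightarrow> nat \<Rightarrow> nat hypergraph set" where
  "blow_up_images H m = {image_hypergraph f (blow_up H m) | f N. admissible_map H m N f}"

text \<open>\<open>W 1, \<dots>, W r\<close> are the parts of a (not necessarily induced) copy of \<open>K\<^sup>r[t]\<close> in \<open>G\<close>.\<close>

definition complete_partite_copy ::
    "'a hypergraph \<Rightarrow> nat \<Rightarrow> nat \<Rightarrow> (nat \<Rightarrow> 'a set) \<Rightarrow> bool" where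
  "complete_partite_copy G r t W \<longleftrightarrow>
     (\<forall>j\<in>{1..r}. W j \<subseteq> verts G \<and> card (W j) = t) \<and>
     disjoint_family_on W {1..r} \<and>
     (\<forall>w. (\<forall>j\<in>{1..r}. w j \<in> W j) \<longrightarrow> w ` {1..r} \<in> edges G)"

text \<open>Meaningful when the edge set of \<open>G\<close> is finite, as \<^const>\<open>Pi_pmf\<close> requires.\<close>

definition random_subhypergraph :: "'a hypergraph \<Rightarrow> real \<Rightarrow> 'a hypergraph pmf" where
  "random_subhypergraph G p =
     map_pmf (\<lambda>b. Hypergraph (verts G) {e \<in> edges G. b e})
       (Pi_pmf (edges G) False (\<lambda>_. bernoulli_pmf p))"

end

theory Submission imports Defs begin

text \<open>Given a \<open>d\<close>-coloring of \<open>G\<close>, each fibre \<open>{f (v, i) | i}\<close> contains \<open>\<lceil>m/d\<rceil>\<close> vertices of one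
  color \<open>a v\<close>. Since \<open>a\<close> cannot be a proper \<open>d\<close>-coloring of \<open>H\<close>, it is constant on some edge \<open>e\<close>, and
  the chosen parts of the fibres over \<open>e\<close> form the monochromatic complete \<open>r\<close>-partite hypergraph.
  If \<open>G(p)\<close> is \<open>d\<close>-colorable, then it misses all edges of one of these complete \<open>r\<close>-partite
  hypergraphs; there are at most \<open>|E| (m choose \<lceil>m/d\<rceil>)^r\<close> of them, and the union bound applies.\<close>

section \<open>Pigeonhole and the chromatic number\<close>

lemma pigeonhole_ceiling:
  fixes g :: "'b \<Rightarrow> nat"
  assumes "finite A" "g \<in> A \<rightarrow> {1..d}" "d \<ge> 1"
  obtains a where "a \<in> {1..d}" "nat \<lceil>real (card A) / real d\<rceil> \<le> card {x \<in> A. g x = a}"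
proof (rule ccontr)
  note witness = that
  assume "\<not> thesis"
  then have small: "card {x \<in> A. g x = a} < nat \<lceil>real (card A) / real d\<rceil>" if "a \<in> {1..d}" for a
    using \<open>\<not> thesis\<close> witness that by (meson not_le)
  \<comment> \<open>An integer below the ceiling of a real number is below the number itself. So if
    every color class were too small, summing the \<open>d\<close> sizes would give strictly less
    than \<open>card A\<close>.\<close>
  have "real (card {x \<in> A. g x = a}) < real (card A) / real d" if "a \<in> {1..d}" for a
    using small[OF that] by linarith
  then have "(\<Sum>a\<in>{1..d}. real (card {x \<in> A. g x = a})) < (\<Sum>a\<in>{1..d}. real (card A) / real d)"
    using \<open>d \<ge> 1\<close> by (intro sum_strict_mono) auto
  also have "\<dots> = real (card A)"
    using \<open>d \<ge> 1\<close> by simp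
  also have "card A = (\<Sum>a\<in>{1..d}. card {x \<in> A. g x = a})"
    using sum.group[of A "{1..d}" g "\<lambda>_. 1::nat"] assms(1,2)
    by (simp add: image_subset_iff_funcset)
  finally show False
    by simp
qed

lemma proper_coloring_mono:
  "proper_coloring H k c \<Longrightarrow> k \<le> d \<Longrightarrow> proper_coloring H d c"
  unfolding proper_coloring_def by fastforce

text \<open>The infimum of a nonempty set in \<open>enat\<close> is its least element, hence
  attained by some \<open>k\<close>; spare colors then raise \<open>k\<close> to \<open>d\<close>.
  The empty set is excluded because its infimum is infinite.\<close>

lemma chromatic_number_le_iff:
  "chromatic_number H \<le> enat d \<longleftrightarrow> (\<exists>c. proper_coloring H d c)"
proof
  let ?K = "{enat k | k. \<exists>c. proper_coloring H k c}"
  assume le: "chromatic_number H \<le> enat d"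
  have "?K \<noteq> {}"
  proof
    assume "?K = {}"
    then have "chromatic_number H = \<infinity>"
      unfolding chromatic_number_def by (simp only: Inf_enat_def simp_thms if_True)
    then show False
      using le by simp
  qed
  then have "(LEAST x. x \<in> ?K) \<in> ?K"
    by (rule LeastI_ex[OF ex_in_conv[THEN iffD2]])
  then have "chromatic_number H \<in> ?K"
    using \<open>?K \<noteq> {}\<close> unfolding chromatic_number_def Inf_enat_def by simp
  then obtain k c where "chromatic_number H = enat k" "proper_coloring H k c"
    by blast
  then show "\<exists>c. proper_coloring H d c"
    using le by (metis enat_ord_simps(1) proper_coloring_mono)
next
  assume "\<exists>c. proper_coloring H d c"
  then show "chromatic_number H \<le> enat d"
    unfolding chromatic_number_def by (auto intro!: Inf_lower)
qed

section \<open>Blow-ups and admissible maps\<close>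

lemma blow_up_edgeI:
  "e \<in> edges H \<Longrightarrow> i \<in> e \<rightarrow> {1..m} \<Longrightarrow> (\<lambda>v. (v, i v)) ` e \<in> edges (blow_up H m)"
  unfolding blow_up_def by auto

lemma finite_edges_blow_up:
  assumes "uniform_hypergraph r H"
  shows "finite (edges (blow_up H m))"
proof (rule finite_subset)
  show "edges (blow_up H m) \<subseteq> Pow (verts H \<times> {1..m})"
    using assms unfolding blow_up_def uniform_hypergraph_def by fastforce
  show "finite (Pow (verts H \<times> {1..m}))"
    using assms unfolding uniform_hypergraph_def by auto
qed

text \<open>Points in one fibre are separated by the first condition of admissibility. Points over
  distinct vertices of \<open>e\<close> lie in a common edge of the blow-up, so the second condition
  separates them.\<close>

lemma admissible_map_inj_on:
  assumes f: "admissible_map H m N f" and e: "e \<in> edges H" "e \<subseteq> verts H"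
  shows "inj_on f (e \<times> {1..m})"
proof (rule inj_onI, clarify)
  fix u v i j
  assume A: "u \<in> e" "i \<in> {1..m}" "v \<in> e" "j \<in> {1..m}" "f (u, i) = f (v, j)"
  show "u = v \<and> i = j"
  proof (cases "u = v")
    case True
    then show ?thesis
      using f A e unfolding admissible_map_def by blast
  next
    case False
    \<comment> \<open>The graph of this index function on \<open>e\<close> is a blow-up edge through
      both \<open>(u, i)\<close> and \<open>(v, j)\<close>.\<close>
    let ?k = "\<lambda>x. if x = u then i else j"
    have "(\<lambda>v. (v, ?k v)) ` e \<in> edges (blow_up H m)"
      using A e by (intro blow_up_edgeI) auto
    moreover have "(u, i) \<in> (\<lambda>v. (v, ?k v)) ` e" "(v, j) \<in> (\<lambda>v. (v, ?k v)) ` e"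
      using A False by auto
    moreover have "\<forall>x\<in>e'. \<forall>y\<in>e'. x \<noteq> y \<longrightarrow> f x \<noteq> f y" if "e' \<in> edges (blow_up H m)" for e'
      using f that unfolding admissible_map_def by blast
    ultimately have "(u, i) \<noteq> (v, j) \<longrightarrow> f (u, i) \<noteq> f (v, j)"
      by meson
    then show ?thesis
      using A False by simp
  qed
qed

section \<open>Monochromatic complete partite subhypergraphs\<close>

lemma monochromatic_subset: "monochromatic c T \<Longrightarrow> S \<subseteq> T \<Longrightarrow> monochromatic c S"
  unfolding monochromatic_def by blast

lemma monochromatic_partite_in_blow_up:
  fixes f :: "'a \<times> nat \<Rightarrow> 'b"
  assumes H: "uniform_hypergraph r H" and "d \<ge> 1"
    and not_col: "\<not> chromatic_number H \<le> enat d"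
    and c: "c \<in> f ` verts (blow_up H m) \<rightarrow> {1..d}"
  obtains e S where "e \<in> edges H"
    "S \<in> e \<rightarrow>\<^sub>E {T. T \<subseteq> {1..m} \<and> card T = nat \<lceil>real m / real d\<rceil>}"
    "monochromatic c (f ` Sigma e S)"
proof -
  let ?t = "nat \<lceil>real m / real d\<rceil>"
  have "\<exists>a T. a \<in> {1..d} \<and> T \<subseteq> {1..m} \<and> card T = ?t \<and> (\<forall>i\<in>T. c (f (v, i)) = a)"
    if v: "v \<in> verts H" for v
  proof -
    have "(\<lambda>i. c (f (v, i))) \<in> {1..m} \<rightarrow> {1..d}"
      using c v unfolding blow_up_def by auto
    then obtain a where a: "a \<in> {1..d}" "?t \<le> card {i \<in> {1..m}. c (f (v, i)) = a}"
      using pigeonhole_ceiling[of "{1..m}" "\<lambda>i. c (f (v, i))" d] \<open>d \<ge> 1\<close> by auto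
    obtain T where "T \<subseteq> {i \<in> {1..m}. c (f (v, i)) = a}" "card T = ?t"
      using obtain_subset_with_card_n[OF a(2)] by blast
    then show ?thesis
      using a(1) by (intro exI[of _ a] exI[of _ T]) auto
  qed
  then obtain a S where aS: "\<And>v. v \<in> verts H \<Longrightarrow> a v \<in> {1..d} \<and> S v \<subseteq> {1..m} \<and>
      card (S v) = ?t \<and> (\<forall>i\<in>S v. c (f (v, i)) = a v)"
    by metis
  \<comment> \<open>The majority colors \<open>a\<close> form a \<open>d\<close>-coloring of
    \<open>H\<close>, so some edge \<open>e\<close> violates properness.\<close>
  have "\<not> proper_coloring H d a"
    using not_col chromatic_number_le_iff by blast
  then obtain e where e: "e \<in> edges H" "monochromatic a e"
    using aS unfolding proper_coloring_def by blast
  have sub: "e \<subseteq> verts H"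
    using H e unfolding uniform_hypergraph_def by blast
  \<comment> \<open>Restricting \<open>S\<close> to \<open>e\<close> makes it extensional, so that
    the possible choices over \<open>e\<close> form a finite set that can be counted in the union
    bound.\<close>
  have "restrict S e \<in> e \<rightarrow>\<^sub>E {T. T \<subseteq> {1..m} \<and> card T = ?t}"
    using aS sub by auto
  moreover have "monochromatic c (f ` Sigma e (restrict S e))"
    using e(2) aS sub unfolding monochromatic_def by force
  ultimately show thesis
    using that e(1) by blast
qed

text \<open>The parts are the images of the selected pieces of the fibres over \<open>e\<close>.
  Injectivity of \<open>f\<close> on all these fibres together preserves their sizes and their
  disjointness.\<close>

lemma complete_partite_copy_blow_up_image:
  assumes H: "uniform_hypergraph r H" and f: "admissible_map H m N f" and e: "e \<in> edges H"
    and S: "S \<in> e \<rightarrow>\<^sub>E {T. T \<subseteq> {1..m} \<and> card T = t}"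
  obtains W where "complete_partite_copy (image_hypergraph f (blow_up H m)) r t W"
    "(\<Union>j\<in>{1..r}. W j) = f ` Sigma e S"
proof -
  have sub: "e \<subseteq> verts H" and "card e = r" and fin: "finite e"
    using H e finite_subset unfolding uniform_hypergraph_def by auto
  then obtain h where h: "bij_betw h {1..r} e"
    using ex_bij_betw_nat_finite_1 by blast
  have he: "h j \<in> e" if "j \<in> {1..r}" for j
    using h that bij_betwE by blast
  have Sm: "S v \<subseteq> {1..m}" "card (S v) = t" if "v \<in> e" for v
    using S that by auto
  have inj: "inj_on f (e \<times> {1..m})"
    using admissible_map_inj_on[OF f e sub] .
  define W where "W = (\<lambda>j. f ` ({h j} \<times> S (h j)))"
  have "W j \<subseteq> f ` verts (blow_up H m)" if "j \<in> {1..r}" for j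
    using he[OF that] Sm sub unfolding W_def blow_up_def by fastforce
  moreover have "card (W j) = t" if "j \<in> {1..r}" for j
  proof -
    have "inj_on f ({h j} \<times> S (h j))"
      using he[OF that] Sm by (intro inj_on_subset[OF inj]) auto
    then show ?thesis
      using Sm[OF he[OF that]] unfolding W_def by (simp add: card_image card_cartesian_product)
  qed
  moreover have "disjoint_family_on W {1..r}"
    unfolding disjoint_family_on_def
  proof (intro ballI impI)
    fix j k
    assume jk: "j \<in> {1..r}" "k \<in> {1..r}" "j \<noteq> k"
    then have "h j \<noteq> h k"
      using h unfolding bij_betw_def inj_on_def by blast
    then have "({h j} \<times> S (h j)) \<inter> ({h k} \<times> S (h k)) = {}"
      by auto
    then show "W j \<inter> W k = {}"
      using inj_on_image_Int[OF inj, of "{h j} \<times> S (h j)" "{h k} \<times> S (h k)"] he jk Sm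
      unfolding W_def by auto
  qed
  moreover have "w ` {1..r} \<in> (`) f ` edges (blow_up H m)" if w: "\<forall>j\<in>{1..r}. w j \<in> W j" for w
  proof -
    have "\<forall>j\<in>{1..r}. \<exists>i. i \<in> S (h j) \<and> w j = f (h j, i)"
      using w unfolding W_def by auto
    then obtain i where i: "\<And>j. j \<in> {1..r} \<Longrightarrow> i j \<in> S (h j) \<and> w j = f (h j, i j)"
      by metis
    \<comment> \<open>The inverse of the enumeration \<open>h\<close> turns indices chosen per part
      into an index function on the vertices of \<open>e\<close>, whose graph is a blow-up
      edge.\<close>
    define g where "g = the_inv_into {1..r} h"
    have g: "g (h j) = j" if "j \<in> {1..r}" for j
      using h that unfolding g_def bij_betw_def by (simp add: the_inv_into_f_f)
    have eh: "e = h ` {1..r}"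
      using h by (simp add: bij_betw_def)
    have "(i \<circ> g) \<in> e \<rightarrow> {1..m}"
      unfolding eh using i g he Sm by fastforce
    then have "(\<lambda>v. (v, (i \<circ> g) v)) ` e \<in> edges (blow_up H m)"
      using e by (rule blow_up_edgeI[rotated])
    moreover have "w ` {1..r} = f ` (\<lambda>v. (v, (i \<circ> g) v)) ` e"
      unfolding eh image_image using i g by (intro image_cong) auto
    ultimately show ?thesis
      by blast
  qed
  ultimately have "complete_partite_copy (image_hypergraph f (blow_up H m)) r t W"
    unfolding complete_partite_copy_def image_hypergraph_def by auto
  moreover have "(\<Union>j\<in>{1..r}. W j) = f ` Sigma e S"
    using h unfolding W_def bij_betw_def by fastforce
  ultimately show thesis
    using that by blast
qed

section \<open>Transversals and the probability of missing them all\<close>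

definition transversals :: "('a \<times> nat \<Rightarrow> 'b) \<Rightarrow> 'a set \<Rightarrow> ('a \<Rightarrow> nat set) \<Rightarrow> 'b set set" where
  "transversals f e S = (\<lambda>i. f ` (\<lambda>v. (v, i v)) ` e) ` (PiE e S)"

lemma transversals_subset:
  assumes "A \<in> transversals f e S"
  shows "A \<subseteq> f ` Sigma e S"
  using assms unfolding transversals_def by (auto simp: PiE_def Pi_def)

text \<open>Injectivity allows \<open>f\<close> to be cancelled, and a graph over \<open>e\<close>
  determines its index function there. Extensionality in \<open>PiE\<close> makes that function
  unique, so the count is a product of part sizes.\<close>

lemma card_transversals:
  assumes "finite e" "inj_on f (e \<times> {1..m})"
    and S: "S \<in> e \<rightarrow>\<^sub>E {T. T \<subseteq> {1..m} \<and> card T = t}"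
  shows "card (transversals f e S) = t ^ card e"
proof -
  have Sm: "S v \<subseteq> {1..m}" "card (S v) = t" if "v \<in> e" for v
    using S that by auto
  have "inj_on (\<lambda>i. f ` (\<lambda>v. (v, i v)) ` e) (PiE e S)"
  proof (rule inj_onI)
    fix i j
    assume ij: "i \<in> PiE e S" "j \<in> PiE e S"
      and eq: "f ` (\<lambda>v. (v, i v)) ` e = f ` (\<lambda>v. (v, j v)) ` e"
    have "(\<lambda>v. (v, k v)) ` e \<subseteq> e \<times> {1..m}" if "k \<in> PiE e S" for k
    proof (rule image_subsetI)
      fix v
      assume "v \<in> e"
      then have "k v \<in> {1..m}"
        using PiE_mem[OF that] Sm by blast
      then show "(v, k v) \<in> e \<times> {1..m}"
        using \<open>v \<in> e\<close> by simp
    qed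
    then have "(\<lambda>v. (v, i v)) ` e = (\<lambda>v. (v, j v)) ` e"
      using inj_on_image_eq_iff[OF assms(2)] eq ij by simp
    then have "i v = j v" if "v \<in> e" for v
      using that by auto
    then show "i = j"
      using ij by (intro PiE_ext) auto
  qed
  then have "card (transversals f e S) = (\<Prod>v\<in>e. card (S v))"
    unfolding transversals_def using assms(1) by (simp add: card_image card_PiE)
  then show ?thesis
    using Sm by simp
qed

text \<open>The event requires the independent coins of all edges in \<open>A\<close> to show
  \<open>False\<close>. Each contributes a factor \<open>1 - p\<close>; every other edge is
  unconstrained and contributes 1.\<close>

lemma prob_random_subhypergraph_avoids:
  assumes "finite (edges G)" "A \<subseteq> edges G" "0 \<le> p" "p \<le> 1"
  shows "measure_pmf.prob (random_subhypergraph G p) {G'. A \<inter> edges G' = {}} = (1 - p) ^ card A"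
proof -
  have "(\<lambda>b. Hypergraph (verts G) {e \<in> edges G. b e}) -` {G'. A \<inter> edges G' = {}} =
      Pi A (\<lambda>_. {False})"
    using assms(2) by (auto simp: Pi_def)
  then have "measure_pmf.prob (random_subhypergraph G p) {G'. A \<inter> edges G' = {}} =
      measure_pmf.prob (Pi_pmf (edges G) False (\<lambda>_. bernoulli_pmf p)) (Pi A (\<lambda>_. {False}))"
    unfolding random_subhypergraph_def measure_map_pmf by simp
  also have "Pi A (\<lambda>_. {False}) = Pi (edges G) (\<lambda>x. if x \<in> A then {False} else UNIV)"
    using assms(2) by (auto simp: Pi_def)
  also have "measure_pmf.prob (Pi_pmf (edges G) False (\<lambda>_. bernoulli_pmf p)) \<dots> =
      (\<Prod>x\<in>edges G. measure_pmf.prob (bernoulli_pmf p) (if x \<in> A then {False} else UNIV))"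
    using assms(1) by (simp add: measure_Pi_pmf_Pi)
  also have "\<dots> = (\<Prod>x\<in>edges G. if x \<in> A then 1 - p else 1)"
    using assms(3,4) by (intro prod.cong) (auto simp: measure_pmf_single)
  also have "\<dots> = (1 - p) ^ card A"
    using assms(1,2) by (simp add: prod.If_cases Int_absorb1)
  finally show ?thesis .
qed

theorem theorem2:
  fixes H :: "'a hypergraph" and G :: "nat hypergraph" and r d m :: nat
  assumes "uniform_hypergraph r H"
    and "d \<ge> 1"
    and "chromatic_number H = enat (d + 1)"
    and "G \<in> blow_up_images H m"
  shows "(\<forall>c \<in> verts G \<rightarrow> {1..d}.
            \<exists>W. complete_partite_copy G r (nat \<lceil>real m / real d\<rceil>) W \<and>
                monochromatic c (\<Union>j\<in>{1..r}. W j)) \<and>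
         (\<forall>p::real. 0 < p \<and> p < 1 \<longrightarrow>
            measure_pmf.prob (random_subhypergraph G p) {G'. chromatic_number G' \<le> enat d}
              \<le> real (card (edges H)) * real (m choose nat \<lceil>real m / real d\<rceil>) ^ r
                  * (1 - p) ^ (nat \<lceil>real m / real d\<rceil> ^ r))"
proof -
  define t where "t = nat \<lceil>real m / real d\<rceil>"
  define P where "P e = (e \<rightarrow>\<^sub>E {T. T \<subseteq> {1..m} \<and> card T = t})" for e :: "'a set"
  obtain f N where G: "G = image_hypergraph f (blow_up H m)" and f: "admissible_map H m N f"
    using assms(4) unfolding blow_up_images_def by blast
  have vG: "verts G = f ` verts (blow_up H m)" and eG: "edges G = (`) f ` edges (blow_up H m)"
    unfolding G image_hypergraph_def by simp_all
  have edge: "e \<subseteq> verts H" "card e = r" "finite e" if "e \<in> edges H" for e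
    using assms(1) that finite_subset unfolding uniform_hypergraph_def by auto
  have finE: "finite (edges H)"
    by (rule finite_subset[of _ "Pow (verts H)"])
      (use assms(1) in \<open>auto simp: uniform_hypergraph_def\<close>)
  have "\<not> chromatic_number H \<le> enat d"
    using assms(3) by simp
  note mono = monochromatic_partite_in_blow_up[OF assms(1,2) this, of _ f m, folded vG t_def,
      folded P_def]
  have "\<exists>W. complete_partite_copy G r t W \<and> monochromatic c (\<Union>j\<in>{1..r}. W j)"
    if c: "c \<in> verts G \<rightarrow> {1..d}" for c
  proof -
    obtain e S where eS: "e \<in> edges H" "S \<in> P e" "monochromatic c (f ` Sigma e S)"
      using mono[OF c] by blast
    obtain W where "complete_partite_copy G r t W" "(\<Union>j\<in>{1..r}. W j) = f ` Sigma e S"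
      using complete_partite_copy_blow_up_image[OF assms(1) f eS(1)] eS(2)
      unfolding P_def G by metis
    then show ?thesis
      using eS(3) by auto
  qed
  moreover have "measure_pmf.prob (random_subhypergraph G p) {G'. chromatic_number G' \<le> enat d}
      \<le> real (card (edges H)) * real (m choose t) ^ r * (1 - p) ^ (t ^ r)"
    if p: "0 < p" "p < 1" for p :: real
  proof -
    let ?M = "random_subhypergraph G p"
    \<comment> \<open>The events are indexed by pairs \<open>(e, S)\<close>. Distinct pairs may
      yield the same transversals, which is harmless for an upper bound.\<close>
    let ?avoid = "\<lambda>(e, S). {G' :: nat hypergraph. transversals f e S \<inter> edges G' = {}}"
    have finP: "finite (P e)" and cardP: "card (P e) = (m choose t) ^ r" if "e \<in> edges H" for e
      unfolding P_def using edge[OF that] by (simp_all add: finite_PiE card_PiE n_subsets)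
    have finI: "finite (Sigma (edges H) P)"
      using finE finP by blast
    \<comment> \<open>Samples in the support have vertex set \<open>verts G\<close>, so a proper
      coloring of such a \<open>G'\<close> is also a coloring of all vertices of
      \<open>G\<close>.\<close>
    have "measure_pmf.prob ?M {G'. chromatic_number G' \<le> enat d} =
        measure_pmf.prob ?M ({G'. chromatic_number G' \<le> enat d} \<inter> set_pmf ?M)"
      by (simp add: measure_Int_set_pmf)
    also have "\<dots> \<le> measure_pmf.prob ?M (\<Union>x\<in>Sigma (edges H) P. ?avoid x)"
    proof (rule measure_pmf.finite_measure_mono)
      show "{G'. chromatic_number G' \<le> enat d} \<inter> set_pmf ?M \<subseteq> (\<Union>x\<in>Sigma (edges H) P. ?avoid x)"
      proof
        fix G'
        assume G': "G' \<in> {G'. chromatic_number G' \<le> enat d} \<inter> set_pmf ?M"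
        then obtain c where c: "proper_coloring G' d c"
          using chromatic_number_le_iff by blast
        have "verts G' = verts G"
          using G' unfolding random_subhypergraph_def by auto
        then have "c \<in> verts G \<rightarrow> {1..d}"
          using c unfolding proper_coloring_def by simp
        then obtain e S where eS: "e \<in> edges H" "S \<in> P e" "monochromatic c (f ` Sigma e S)"
          using mono by blast
        \<comment> \<open>Every transversal lies inside a monochromatic set, so the proper coloring
          \<open>c\<close> forbids it as an edge of \<open>G'\<close>.\<close>
        have "A \<notin> edges G'" if "A \<in> transversals f e S" for A
          using c monochromatic_subset[OF eS(3) transversals_subset[OF that]]
          unfolding proper_coloring_def by blast
        then have "transversals f e S \<inter> edges G' = {}"
          by blast
        then show "G' \<in> (\<Union>x\<in>Sigma (edges H) P. ?avoid x)"
          using eS by blast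
      qed
    qed simp
    also have "\<dots> \<le> (\<Sum>x\<in>Sigma (edges H) P. measure_pmf.prob ?M (?avoid x))"
      using finI by (intro measure_pmf.finite_measure_subadditive_finite) auto
    also have "\<dots> = (\<Sum>x\<in>Sigma (edges H) P. (1 - p) ^ (t ^ r))"
    proof (rule sum.cong[OF refl], clarify)
      fix e S
      assume e: "e \<in> edges H" and S: "S \<in> P e"
      have "transversals f e S \<subseteq> edges G"
      proof
        fix A
        assume "A \<in> transversals f e S"
        then obtain i where i: "i \<in> PiE e S" "A = f ` (\<lambda>v. (v, i v)) ` e"
          unfolding transversals_def by blast
        then have "i \<in> e \<rightarrow> {1..m}"
          using S unfolding P_def by fastforce
        then show "A \<in> edges G"
          using i(2) blow_up_edgeI[OF e] unfolding eG by blast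
      qed
      moreover have "card (transversals f e S) = t ^ r"
        using card_transversals[OF _ admissible_map_inj_on[OF f e]] edge[OF e] S
        unfolding P_def by blast
      ultimately show "measure_pmf.prob ?M {G'. transversals f e S \<inter> edges G' = {}} =
          (1 - p) ^ (t ^ r)"
        using prob_random_subhypergraph_avoids[of G "transversals f e S" p] p
          finite_edges_blow_up[OF assms(1)] by (simp add: eG)
    qed
    \<comment> \<open>For each edge of \<open>H\<close>, every one of its \<open>r\<close> vertices
      has \<open>m choose t\<close> possible index sets.\<close>
    also have "\<dots> = real (card (edges H)) * real (m choose t) ^ r * (1 - p) ^ (t ^ r)"
      using finE finP cardP by (simp add: card_SigmaI)
    finally show ?thesis .
  qed
  ultimately show ?thesis
    unfolding t_def by blast
qed

end
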